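(* Let $n\ge 1$, let $\mathcal{D}$ be a probability distribution on $n\times n$ complex matrices, and let $\tau,\delta>0$. For an $n\times n$ complex matrix $M$, let $k_M$ be the number of eigenvalues $\lambda$ of $M$ such that $|\lambda|>\tau\sqrt{1+\delta}$. Then $$\mathbb{E}_{M\sim\mathcal{D}}\,(1+\delta)^{k_M}\ \le\ \mathbb{E}_{\theta\sim[0,2\pi]}\,\mathbb{E}_{M\sim\mathcal{D}}\left|\det\left(I-\frac{e^{\mathrm{i}\theta}}{\tau}\cdot M\right)\right|^2 .$$
   Context: Eigenvalues are counted with algebraic multiplicity. $I$ is the $n\times n$ identity matrix, $\mathrm{i}$ is the imaginary unit, and $\theta\sim[0,2\pi]$ means $\theta$ is uniform on $[0,2\pi]$. Expectations of nonnegative quantities take values in $[0,\infty]$. *)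

theory Defs
  imports "HOL-Probability.Probability" "HOL-Computational_Algebra.Polynomial"
begin

definition eigenvalue :: "complex ^ 'n ^ 'n \<Rightarrow> complex \<Rightarrow> bool" where
  "eigenvalue M l \<longleftrightarrow> (\<exists>v. v \<noteq> 0 \<and> M *v v = l *s v)"

(* The determinant of X I - M, taken over the polynomial ring. *)
definition charpoly :: "complex ^ 'n ^ 'n \<Rightarrow> complex poly" where
  "charpoly M = det (\<chi> i j. (if i = j then [:0, 1:] else 0) - [:M $ i $ j:])"

definition alg_mult :: "complex ^ 'n ^ 'n \<Rightarrow> complex \<Rightarrow> nat" where
  "alg_mult M l = order l (charpoly M)"

definition num_eigenvalues_outside :: "real \<Rightarrow> complex ^ 'n ^ 'n \<Rightarrow> nat" where
  "num_eigenvalues_outside r M = (\<Sum>l | eigenvalue M l \<and> cmod l > r. alg_mult M l)"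

lemma poly_charpoly: "poly (charpoly M) l = det (mat l - M)"
  unfolding charpoly_def det_def mat_def
  by (auto simp: poly_sum poly_prod sign_def intro!: sum.cong prod.cong)

lemma eigenvalue_iff_root: "eigenvalue M l \<longleftrightarrow> poly (charpoly M) l = 0"
proof -
  have *: "mat l *v v = l *s v" for v :: "complex ^ 'n"
    by (simp add: vec_eq_iff matrix_vector_mult_def mat_def if_distrib if_distribR cong: if_cong)
  have "eigenvalue M l \<longleftrightarrow> (\<exists>v. v \<noteq> 0 \<and> (mat l - M) *v v = 0)"
    unfolding eigenvalue_def matrix_vector_mult_diff_rdistrib * by auto
  also have "\<dots> \<longleftrightarrow> \<not> invertible (mat l - M)"
    unfolding invertible_left_inverse matrix_left_invertible_ker by auto
  also have "\<dots> \<longleftrightarrow> poly (charpoly M) l = 0"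
    unfolding invertible_det_nz poly_charpoly by simp
  finally show ?thesis .
qed

end

theory Submission
  imports Defs "HOL-Computational_Algebra.Fundamental_Theorem_Algebra"
begin

text \<open>By Tonelli it suffices to treat a single matrix. Its eigenvalues factor
  \<open>det (1 - w M)\<close> as the product of the \<open>1 - w z\<close>. On the unit circle \<open>1 - w z\<close> has the same
  modulus as \<open>w - cnj z\<close>, so the factors of the eigenvalues outside the disc can be exchanged
  without changing the mean square. The mean square of the new polynomial is at least its squared
  modulus at \<open>0\<close>, to which each exchanged factor contributes at least \<open>1 + \<delta>\<close>.\<close>

text \<open>This is \<open>det (1 - w M)\<close> as a polynomial in \<open>w\<close>. Taken as a
  determinant of linear polynomials, it has constant term 1 without any appeal to the degree of
  \<open>charpoly M\<close>.\<close>

definition rev_charpoly :: "complex ^ 'n ^ 'n \<Rightarrow> complex poly" where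
  "rev_charpoly M = det (\<chi> i j. [:if i = j then 1 else 0, - (M $ i $ j):])"

lemma poly_rev_charpoly: "poly (rev_charpoly M) w = det (mat 1 - (\<chi> i j. w * M $ i $ j))"
  unfolding rev_charpoly_def det_def mat_def
  by (auto simp: poly_sum poly_prod sign_def intro!: sum.cong prod.cong)

lemma poly_rev_charpoly_0: "poly (rev_charpoly (M :: complex ^ 'n ^ 'n)) 0 = 1"
proof -
  have "mat 1 - (\<chi> i j. 0 * M $ i $ j) = (mat 1 :: complex ^ 'n ^ 'n)"
    by (simp add: vec_eq_iff)
  then show ?thesis
    by (metis poly_rev_charpoly det_I)
qed

text \<open>Since \<open>1 - w M = w (1 / w - M)\<close>, each of the \<open>CARD('n)\<close> rows
  yields a factor \<open>w\<close>.\<close>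

lemma poly_rev_charpoly_nz:
  fixes M :: "complex ^ 'n ^ 'n"
  assumes "w \<noteq> 0"
  shows "poly (rev_charpoly M) w = w ^ CARD('n) * poly (charpoly M) (1 / w)"
proof -
  have "mat 1 - (\<chi> i j. w * M $ i $ j) = (\<chi> i. w *s (mat (1 / w) - M) $ i)"
    using assms by (auto simp: vec_eq_iff mat_def algebra_simps)
  then show ?thesis
    unfolding poly_rev_charpoly poly_charpoly
    by (simp only: det_rows_mul prod_constant vec_lambda_eta)
qed

text \<open>Otherwise \<open>rev_charpoly M\<close> would vanish at every nonzero point, hence
  identically, against its value 1 at 0.\<close>

lemma charpoly_nonzero: "charpoly M \<noteq> 0"
proof
  assume "charpoly M = 0"
  then have "poly (rev_charpoly M) w = 0" if "w \<noteq> 0" for w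
    using poly_rev_charpoly_nz[OF that, of M] by simp
  then have "UNIV - {0} \<subseteq> {w. poly (rev_charpoly M) w = 0}"
    by auto
  moreover have "infinite (UNIV - {0 :: complex})"
    by (simp add: infinite_UNIV_char_0)
  ultimately have "rev_charpoly M = 0"
    using finite_subset poly_roots_finite by blast
  then show False
    using poly_rev_charpoly_0[of M] by simp
qed

text \<open>That \<open>charpoly M\<close> has degree \<open>CARD('n)\<close> is read off by comparing the orders of vanishing
  at \<open>0\<close>; the same identity at \<open>0\<close> later shows that it is monic.\<close>

lemma reflect_charpoly:
  fixes M :: "complex ^ 'n ^ 'n"
  shows "reflect_poly (charpoly M) = rev_charpoly M"
proof -
  let ?n = "CARD('n)" and ?d = "degree (charpoly M)"
  let ?f = "rev_charpoly M" and ?r = "reflect_poly (charpoly M)"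
  \<comment> \<open>Both sides equal \<open>w ^ (?n + ?d) * poly (charpoly M) (1 / w)\<close>. The
    monomials balance the two possibly different powers of \<open>w\<close>.\<close>
  have "poly (monom 1 ?d * ?f) w = poly (monom 1 ?n * ?r) w" if "w \<noteq> 0" for w
    using that by (simp add: poly_monom poly_reflect_poly_nz poly_rev_charpoly_nz inverse_eq_divide)
  then have "UNIV - {0} \<subseteq> {w. poly (monom 1 ?d * ?f - monom 1 ?n * ?r) w = 0}"
    by auto
  moreover have "infinite (UNIV - {0 :: complex})"
    by (simp add: infinite_UNIV_char_0)
  ultimately have eq: "monom 1 ?d * ?f = monom 1 ?n * ?r"
    using finite_subset poly_roots_finite right_minus_eq by blast
  have f0: "poly ?f 0 \<noteq> 0" and r0: "poly ?r 0 \<noteq> 0"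
    using charpoly_nonzero[of M] by (simp_all add: poly_rev_charpoly_0)
  have "order 0 (monom 1 k * p) = k" if "poly p 0 \<noteq> 0" for k and p :: "complex poly"
  proof -
    have "p \<noteq> 0" using that by auto
    moreover have "order 0 p = 0" using that by (simp add: order_0I)
    ultimately show ?thesis by (subst order_mult) (auto simp: order_0_monom)
  qed
  from this[OF f0, of ?d] this[OF r0, of ?n] eq have "?d = ?n"
    by simp
  with eq show ?thesis
    by simp
qed

text \<open>\<open>charpoly M\<close> splits over the complex numbers, and reflection turns each
  factor \<open>X - z\<close> into \<open>1 - z X\<close>. An eigenvalue 0 contributes the factor
  1.\<close>

lemma rev_charpoly_factorization:
  "rev_charpoly M = (\<Prod>z | eigenvalue M z. [:1, - z:] ^ alg_mult M z)"
proof -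
  let ?p = "charpoly M"
  have lin: "reflect_poly [:- z, 1:] = [:1, - z:]" for z :: complex
    by (simp add: reflect_poly_def)
  have "reflect_poly ?p = smult (lead_coeff ?p) (\<Prod>z | eigenvalue M z. [:1, - z:] ^ alg_mult M z)"
    unfolding eigenvalue_iff_root alg_mult_def
    by (subst complex_poly_decompose[symmetric])
      (simp add: reflect_poly_smult reflect_poly_prod reflect_poly_power lin)
  moreover have "lead_coeff ?p = 1"
    using poly_rev_charpoly_0[of M]
    by (simp flip: reflect_charpoly add: poly_0_coeff_0)
  ultimately show ?thesis
    by (simp add: reflect_charpoly)
qed

abbreviation circle_measure :: "real measure" where
  "circle_measure \<equiv> uniform_measure lborel {0..2 * pi}"

lemma prob_space_circle_measure: "prob_space circle_measure"
  by (rule prob_space_uniform_measure) auto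

lemma circle_measure_density:
  "circle_measure = density lborel (\<lambda>x. ennreal (indicator {0..2 * pi} x / (2 * pi)))"
  unfolding uniform_measure_def
  by (intro density_cong) (auto simp: divide_ennreal simp flip: ennreal_indicator)

text \<open>The antiderivative \<open>cis (k x) / (i k)\<close> takes the same value at 0 and at
  \<open>2 * pi\<close>.\<close>

lemma integral_cis_power:
  assumes "k > 0"
  shows "(\<integral>x. cis x ^ k \<partial>circle_measure) = 0"
proof -
  let ?F = "\<lambda>x. cis (real k * x) / (\<i> * of_nat k)"
  have "(?F has_vector_derivative cis x ^ k) (at x within A)" for x A
    using assms
    by (auto intro!: derivative_eq_intros simp: has_vector_derivative_def fun_eq_iff
        scaleR_conv_of_real Complex.DeMoivre mult.left_commute)
  then have "(\<integral>x. indicator {0..2 * pi} x *\<^sub>R cis x ^ k \<partial>lborel) = ?F (2 * pi) - ?F 0"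
    by (intro integral_FTC_Icc) (auto intro!: continuous_intros)
  also have "\<dots> = 0"
    using cis_multiple_2pi[of "real k"] by (simp add: algebra_simps)
  finally have zero: "(\<integral>x. indicator {0..2 * pi} x *\<^sub>R cis x ^ k \<partial>lborel) = 0" .
  have "(\<integral>x. cis x ^ k \<partial>circle_measure)
      = (\<integral>x. (indicator {0..2 * pi} x / (2 * pi)) *\<^sub>R cis x ^ k \<partial>lborel)"
    unfolding circle_measure_density
    by (subst integral_density) (auto intro!: borel_measurable_continuous_onI continuous_intros)
  also have "\<dots> = (\<integral>x. (1 / (2 * pi)) *\<^sub>R (indicator {0..2 * pi} x *\<^sub>R cis x ^ k) \<partial>lborel)"
    by (simp only: scaleR_scaleR times_divide_eq_left mult_1)
  also have "\<dots> = 0"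
    by (simp only: integral_scaleR_right zero scaleR_zero_right)
  finally show ?thesis .
qed

text \<open>A continuous function is bounded on the compact unit circle, and the measure is
  finite.\<close>

lemma integrable_circle:
  fixes f :: "complex \<Rightarrow> 'a :: {banach, second_countable_topology}"
  assumes "continuous_on UNIV f"
  shows "integrable circle_measure (\<lambda>x. f (cis x))"
proof -
  interpret prob_space circle_measure
    by (rule prob_space_circle_measure)
  have "compact (f ` sphere 0 1)"
    using assms by (intro compact_continuous_image) (auto intro: continuous_on_subset)
  then obtain B where "\<And>z. z \<in> sphere 0 1 \<Longrightarrow> norm (f z) \<le> B"
    by (meson bounded_iff compact_imp_bounded imageI)
  then have "norm (f (cis x)) \<le> B" for x
    by simp
  moreover have "(\<lambda>x. f (cis x)) \<in> borel_measurable borel"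
    by (intro borel_measurable_continuous_onI continuous_on_compose2[OF assms] continuous_intros) auto
  ultimately show ?thesis
    by (intro integrable_const_bound[of _ B]) auto
qed

text \<open>The positive powers average to 0, so only the constant term survives.\<close>

lemma mean_poly_circle: "(\<integral>x. poly p (cis x) \<partial>circle_measure) = poly p 0"
proof -
  interpret prob_space circle_measure
    by (rule prob_space_circle_measure)
  have "(\<integral>x. poly p (cis x) \<partial>circle_measure)
      = (\<Sum>k\<le>degree p. coeff p k * (\<integral>x. cis x ^ k \<partial>circle_measure))"
    unfolding poly_altdef
    by (subst Bochner_Integration.integral_sum)
      (auto intro!: integrable_circle continuous_intros)
  also have "\<dots> = (\<Sum>k\<in>{0}. coeff p k * (\<integral>x. cis x ^ k \<partial>circle_measure))"
    by (intro sum.mono_neutral_right) (auto simp: integral_cis_power)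
  also have "\<dots> = poly p 0"
    by (simp add: poly_0_coeff_0 prob_space)
  finally show ?thesis .
qed

lemma mean_square_poly_circle:
  "ennreal ((cmod (poly p 0))\<^sup>2) \<le> (\<integral>\<^sup>+x. ennreal ((cmod (poly p (cis x)))\<^sup>2) \<partial>circle_measure)"
proof -
  interpret prob_space circle_measure
    by (rule prob_space_circle_measure)
  let ?a = "poly p 0"
  \<comment> \<open>Expanding \<open>0 \<le> (cmod (poly p z - ?a))\<^sup>2\<close> shows that
    \<open>?g\<close> lies below the squared modulus of \<open>p\<close>. Its mean is exactly
    \<open>(cmod ?a)\<^sup>2\<close>, because \<open>p\<close> has mean \<open>?a\<close>.\<close>
  let ?g = "\<lambda>z. 2 * Re (cnj ?a * poly p z) - (cmod ?a)\<^sup>2"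
  have int: "integrable circle_measure (\<lambda>x. cnj ?a * poly p (cis x))"
    by (intro integrable_circle continuous_intros)
  have "(\<integral>x. ?g (cis x) \<partial>circle_measure)
      = 2 * (\<integral>x. Re (cnj ?a * poly p (cis x)) \<partial>circle_measure) - (cmod ?a)\<^sup>2"
    using integrable_Re[OF int]
    by (subst Bochner_Integration.integral_diff) (auto simp: prob_space simp del: times_complex.sel)
  also have "(\<integral>x. Re (cnj ?a * poly p (cis x)) \<partial>circle_measure)
      = Re (cnj ?a * (\<integral>x. poly p (cis x) \<partial>circle_measure))"
    by (simp only: integral_Re[OF int] integral_mult_right_zero)
  also have "2 * \<dots> - (cmod ?a)\<^sup>2 = (cmod ?a)\<^sup>2"
    unfolding mean_poly_circle unfolding cmod_power2 by (simp add: power2_eq_square)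
  finally have "(cmod ?a)\<^sup>2 = (\<integral>x. ?g (cis x) \<partial>circle_measure)" ..
  also have "\<dots> \<le> (\<integral>x. (cmod (poly p (cis x)))\<^sup>2 \<partial>circle_measure)"
  proof (intro integral_mono integrable_circle continuous_intros)
    fix x
    have "0 \<le> (cmod (poly p (cis x) - ?a))\<^sup>2"
      by simp
    then show "?g (cis x) \<le> (cmod (poly p (cis x)))\<^sup>2"
      unfolding cmod_power2 by (simp add: power2_eq_square algebra_simps)
  qed
  finally have "ennreal ((cmod ?a)\<^sup>2) \<le> ennreal (\<integral>x. (cmod (poly p (cis x)))\<^sup>2 \<partial>circle_measure)"
    by (rule ennreal_leI)
  also have "\<dots> = (\<integral>\<^sup>+x. ennreal ((cmod (poly p (cis x)))\<^sup>2) \<partial>circle_measure)"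
    by (intro nn_integral_eq_integral[symmetric] integrable_circle continuous_intros) auto
  finally show ?thesis .
qed

text \<open>On the unit circle \<open>w * cnj w = 1\<close>, so \<open>1 - w * z\<close> is
  \<open>w\<close> times the conjugate of \<open>w - cnj z\<close>.\<close>

lemma cmod_one_minus_mult_unit:
  assumes "cmod w = 1"
  shows "cmod (1 - w * z) = cmod (w - cnj z)"
proof -
  have "w * cnj w = 1"
    using assms by (simp add: complex_norm_square[symmetric])
  then have "w * cnj (w - cnj z) = 1 - w * z"
    by (simp add: algebra_simps)
  then show ?thesis
    using assms by (metis complex_mod_cnj mult_1 norm_mult)
qed

lemma power_num_eigenvalues_outside_le:
  fixes M :: "complex ^ 'n ^ 'n"
  assumes "\<tau> > 0" and "\<delta> > 0"
  shows "ennreal ((1 + \<delta>) ^ num_eigenvalues_outside (\<tau> * sqrt (1 + \<delta>)) M)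
    \<le> (\<integral>\<^sup>+\<theta>. ennreal ((cmod (det (mat 1 -
          (\<chi> i j. exp (\<i> * complex_of_real \<theta>) / complex_of_real \<tau> * M $ i $ j))))\<^sup>2) \<partial>circle_measure)"
proof -
  let ?E = "{z. eigenvalue M z}" and ?r = "\<tau> * sqrt (1 + \<delta>)"
  define out where "out z \<longleftrightarrow> cmod z > ?r" for z
  \<comment> \<open>The factors of \<open>rev_charpoly M\<close> at \<open>w / \<tau>\<close>, with
    \<open>1 - w z / \<tau>\<close> replaced by \<open>w - cnj (z / \<tau>)\<close> for each outside
    eigenvalue \<open>z\<close>.\<close>
  define q where "q = (\<Prod>z\<in>?E. (if out z then [:- cnj (z / \<tau>), 1:] else [:1, - (z / \<tau>):]) ^ alg_mult M z)"
  have fin: "finite ?E"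
    unfolding eigenvalue_iff_root using charpoly_nonzero by (rule poly_roots_finite)
  have "(1 + \<delta>) ^ num_eigenvalues_outside ?r M = (\<Prod>z | eigenvalue M z \<and> out z. (1 + \<delta>) ^ alg_mult M z)"
    unfolding num_eigenvalues_outside_def out_def by (rule power_sum)
  also have "\<dots> = (\<Prod>z\<in>?E. if out z then (1 + \<delta>) ^ alg_mult M z else 1)"
    using prod.inter_filter[OF fin, of "\<lambda>z. (1 + \<delta>) ^ alg_mult M z" out] by simp
  also have "\<dots> \<le> (\<Prod>z\<in>?E. if out z then ((cmod (z / \<tau>))\<^sup>2) ^ alg_mult M z else 1)"
  proof (rule prod_mono, safe)
    fix z
    have "1 + \<delta> \<le> (cmod (z / \<tau>))\<^sup>2" if "out z"
    proof -
      have "sqrt (1 + \<delta>) \<le> cmod (z / \<tau>)"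
        using that assms by (simp add: out_def norm_divide field_simps)
      then show ?thesis
        by (rule sqrt_le_D)
    qed
    then show "(if out z then (1 + \<delta>) ^ alg_mult M z else 1)
        \<le> (if out z then ((cmod (z / \<tau>))\<^sup>2) ^ alg_mult M z else 1)"
      using assms by (auto intro!: power_mono)
  qed (use assms in auto)
  \<comment> \<open>At 0 a kept factor is 1 and an exchanged one is
    \<open>- cnj (z / \<tau>)\<close>.\<close>
  also have "\<dots> = (cmod (poly q 0))\<^sup>2"
    unfolding q_def poly_prod prod_norm[symmetric] prod_power_distrib
    by (intro prod.cong refl) (simp add: norm_power norm_divide power_mult[symmetric] mult.commute)
  finally have "ennreal ((1 + \<delta>) ^ num_eigenvalues_outside ?r M) \<le> ennreal ((cmod (poly q 0))\<^sup>2)"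
    by (rule ennreal_leI)
  also have "\<dots> \<le> (\<integral>\<^sup>+\<theta>. ennreal ((cmod (poly q (cis \<theta>)))\<^sup>2) \<partial>circle_measure)"
    by (rule mean_square_poly_circle)
  \<comment> \<open>The exchange is undone here: on the circle the moduli agree factor by
    factor.\<close>
  also have "(\<lambda>\<theta>. cmod (poly q (cis \<theta>))) = (\<lambda>\<theta>. cmod (poly (rev_charpoly M) (cis \<theta> / \<tau>)))"
  proof
    fix \<theta>
    show "cmod (poly q (cis \<theta>)) = cmod (poly (rev_charpoly M) (cis \<theta> / \<tau>))"
      unfolding q_def rev_charpoly_factorization poly_prod prod_norm[symmetric]
      using cmod_one_minus_mult_unit[of "cis \<theta>" "z / of_real \<tau>" for z]
      by (intro prod.cong refl) (simp add: norm_power)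
  qed
  finally show ?thesis
    by (simp only: poly_rev_charpoly cis_conv_exp)
qed

theorem corollary1p3:
  fixes D :: "(complex ^ 'n ^ 'n) measure" and \<tau> \<delta> :: real
  assumes "prob_space D" and "sets D = sets borel"
    and "\<tau> > 0" and "\<delta> > 0"
  shows "(\<integral>\<^sup>+ M. ennreal ((1 + \<delta>) ^ num_eigenvalues_outside (\<tau> * sqrt (1 + \<delta>)) M) \<partial>D)
    \<le> (\<integral>\<^sup>+ \<theta>. (\<integral>\<^sup>+ M. ennreal ((cmod (det (mat 1 -
            (\<chi> i j. exp (\<i> * complex_of_real \<theta>) / complex_of_real \<tau> * M $ i $ j))))\<^sup>2) \<partial>D)
        \<partial>uniform_measure lborel {0..2 * pi})"
proof -
  interpret D: prob_space D
    by fact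
  interpret C: prob_space circle_measure
    by (rule prob_space_circle_measure)
  interpret P: pair_sigma_finite D circle_measure ..
  let ?f = "\<lambda>M \<theta>. ennreal ((cmod (det (mat 1 -
      (\<chi> i j. exp (\<i> * complex_of_real \<theta>) / complex_of_real \<tau> * M $ i $ j))))\<^sup>2)"
  have entry [measurable]: "(\<lambda>M. M $ i $ j) \<in> borel_measurable D" for i j
    unfolding measurable_cong_sets[OF assms(2) refl]
    by (intro borel_measurable_continuous_onI continuous_intros)
  have [measurable]: "(\<lambda>\<theta>. exp (\<i> * complex_of_real \<theta>)) \<in> borel_measurable circle_measure"
    by measurable
  \<comment> \<open>Tonelli needs joint measurability. By the Leibniz formula the determinant is a
    finite sum of products of measurable functions of \<open>M\<close> and
    \<open>\<theta>\<close>.\<close>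
  have meas: "case_prod ?f \<in> borel_measurable (D \<Otimes>\<^sub>M circle_measure)"
    unfolding det_def mat_def vector_minus_component vec_lambda_beta by measurable
  have "(\<integral>\<^sup>+ M. ennreal ((1 + \<delta>) ^ num_eigenvalues_outside (\<tau> * sqrt (1 + \<delta>)) M) \<partial>D)
      \<le> (\<integral>\<^sup>+ M. (\<integral>\<^sup>+ \<theta>. ?f M \<theta> \<partial>circle_measure) \<partial>D)"
    using assms by (intro nn_integral_mono power_num_eigenvalues_outside_le)
  also have "\<dots> = (\<integral>\<^sup>+ \<theta>. (\<integral>\<^sup>+ M. ?f M \<theta> \<partial>D) \<partial>circle_measure)"
    using P.Fubini'[OF meas] by simp
  finally show ?thesis .
qed

end
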